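(* Let $G$ and $H$ be connected graphs. (i) If $G$ is a tree and $\frac{|V(H)|}{\lambda(H)}\le |V(G)|$, then $\mathrm{sn}(G\square H)=\mathrm{gon}(G\square H)=|V(H)|$. (ii) If $\mathrm{gon}(H)=\lambda(H)$ and $|V(G)|\le\frac{|V(H)|}{\lambda(H)}$, then $\mathrm{sn}(G\square H)=\mathrm{gon}(G\square H)=|V(G)|\cdot\lambda(H)$.
   Context: Graphs are finite, multiple edges allowed, no loops; $\lambda$ is edge-connectivity (edges counted with multiplicity). $G\square H$ is the Cartesian product (vertex set $V(G)\times V(H)$; $(u_1,v_1),(u_2,v_2)$ joined by $e$ edges iff $u_1=u_2$ and $v_1,v_2$ joined by $e$ edges in $H$, or $v_1=v_2$ and $u_1,u_2$ joined by $e$ edges in $G$). Scramble number $\mathrm{sn}$: a scramble is a finite collection of nonempty vertex sets (eggs) each inducing a connected subgraph; its order is $\min(h,e)$ where $h$ is the minimum size of a vertex set meeting every egg and $e$ is the minimum of $|E(A,A^C)|$ over $A\subseteq V$ containing some egg whose complement contains some egg ($+\infty$ if none); $\mathrm{sn}$ is the maximum order. Gonality: a divisor is an integer combination of vertices; firing a vertex $w$ removes $\mathrm{val}(w)$ chips from $w$ and gives each other vertex one chip per edge to $w$; divisors are equivalent if related by firings; $D$ has positive rank if $D-(v)$ is equivalent to an effective divisor for every vertex $v$; $\mathrm{gon}$ is the minimum degree of a positive rank divisor. *)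

theory Defs
  imports Complex_Main "HOL-Library.Multiset" "HOL-Library.Extended_Nat"
begin

section \<open>Finite loopless multigraphs\<close>

text \<open>An edge is the two-element set of its endpoints; the edges form a multiset, so parallel
  edges are repeated elements.\<close>

datatype 'a mgraph = Mgraph (verts: "'a set") (edges: "'a set multiset")

definition mgraph :: "'a mgraph \<Rightarrow> bool" where
  "mgraph G \<longleftrightarrow> finite (verts G) \<and> (\<forall>e \<in># edges G. e \<subseteq> verts G \<and> card e = 2)"

definition mult :: "'a mgraph \<Rightarrow> 'a \<Rightarrow> 'a \<Rightarrow> nat" where
  "mult G u v = count (edges G) {u, v}"

definition val :: "'a mgraph \<Rightarrow> 'a \<Rightarrow> nat" where
  "val G v = size {#e \<in># edges G. v \<in> e#}"

definition adjacent :: "'a mgraph \<Rightarrow> 'a \<Rightarrow> 'a \<Rightarrow> bool" where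
  "adjacent G u v \<longleftrightarrow> {u, v} \<in># edges G"

definition connected_graph :: "'a mgraph \<Rightarrow> bool" where
  "connected_graph G \<longleftrightarrow>
     verts G \<noteq> {} \<and> (\<forall>u \<in> verts G. \<forall>v \<in> verts G. (adjacent G)\<^sup>*\<^sup>* u v)"

definition induced :: "'a mgraph \<Rightarrow> 'a set \<Rightarrow> 'a mgraph" where
  "induced G A = Mgraph A {#e \<in># edges G. e \<subseteq> A#}"

text \<open>The multiset inclusion demands that a cycle uses each edge at most once. For
  \<open>length vs = 2\<close> it says that the two vertices are joined by at least two parallel edges.\<close>

definition is_cycle :: "'a mgraph \<Rightarrow> 'a list \<Rightarrow> bool" where
  "is_cycle G vs \<longleftrightarrow> length vs \<ge> 2 \<and> distinct vs \<and>
     {#{vs ! i, vs ! (Suc i mod length vs)}. i \<in># mset_set {..<length vs}#} \<subseteq># edges G"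

definition tree :: "'a mgraph \<Rightarrow> bool" where
  "tree G \<longleftrightarrow> connected_graph G \<and> (\<nexists>vs. is_cycle G vs)"

text \<open>A graph with one vertex cannot be disconnected by deleting edges; its edge-connectivity
  is set to 0. In particular a quotient by it is then 0, as if it were infinite.\<close>

definition edge_connectivity :: "'a mgraph \<Rightarrow> nat" where
  "edge_connectivity G =
     (if card (verts G) \<le> 1 then 0
      else (LEAST k. \<exists>F. F \<subseteq># edges G \<and> size F = k \<and>
                         \<not> connected_graph (Mgraph (verts G) (edges G - F))))"

text \<open>If \<open>e\<close> joins \<open>u\<^sub>1\<close> and \<open>u\<^sub>2\<close>, then \<open>e \<times> {v}\<close> joins \<open>(u\<^sub>1, v)\<close> and \<open>(u\<^sub>2, v)\<close>.\<close>

definition cart_prod :: "'a mgraph \<Rightarrow> 'b mgraph \<Rightarrow> ('a \<times> 'b) mgraph"  (infixl "\<box>" 70) where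
  "G \<box> H = Mgraph (verts G \<times> verts H)
     ((\<Sum>v \<in> verts H. {#e \<times> {v}. e \<in># edges G#}) +
      (\<Sum>u \<in> verts G. {#{u} \<times> e. e \<in># edges H#}))"

lemma count_image_inj: assumes i: "inj f" shows "count (image_mset f M) (f x) = count M x"
  by (induction M) (use i in \<open>auto simp: inj_eq\<close>)

lemma count_image_times_singleton:
  "count {#e \<times> {v}. e \<in># M#} {(a, b),(c, d)} = (if b = v \<and> d = v then count M {a, c} else 0)"
proof (cases "b = v \<and> d = v")
  case True
  have i: "inj (\<lambda>e. e \<times> {v})" by (auto simp: inj_on_def)
  have "{(a, b),(c, d)} = {a, c} \<times> {v}" using True by auto
  then show ?thesis using True count_image_inj[OF i, of M "{a, c}"] by simp
next
  case False
  have "{(a, b),(c, d)} \<noteq> e \<times> {v}" for e using False by auto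
  then show ?thesis unfolding if_not_P[OF False] by (auto simp: count_eq_zero_iff)
qed

lemma count_image_singleton_times:
  "count {#{v} \<times> e. e \<in># M#} {(a, b),(c, d)} = (if a = v \<and> c = v then count M {b, d} else 0)"
proof (cases "a = v \<and> c = v")
  case True
  have i: "inj (\<lambda>e. {v} \<times> e)" by (auto simp: inj_on_def)
  have "{(a, b),(c, d)} = {v} \<times> {b, d}" using True by auto
  then show ?thesis using True count_image_inj[OF i, of M "{b, d}"] by simp
next
  case False
  have "{(a, b),(c, d)} \<noteq> {v} \<times> e" for e using False by auto
  then show ?thesis unfolding if_not_P[OF False] by (auto simp: count_eq_zero_iff)
qed

lemma mult_cart_prod:
  assumes "mgraph G" "mgraph H" "a \<in> verts G" "c \<in> verts G" "b \<in> verts H" "d \<in> verts H"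
  shows "mult (G \<box> H) (a, b) (c, d) = (if a = c then mult H b d else if b = d then mult G a c else 0)"
proof -
  have f: "finite (verts G)" "finite (verts H)" and e: "\<forall>e\<in>#edges G. card e = 2" "\<forall>e\<in>#edges H. card e = 2"
    using assms by (auto simp: mgraph_def)
  have z: "count (edges G) {x} = 0" "count (edges H) {y} = 0" for x y
    using e by (auto simp: count_eq_zero_iff)
  have "mult (G \<box> H) (a, b) (c, d) =
      (\<Sum>v \<in> verts H. if b = v \<and> d = v then count (edges G) {a, c} else 0) +
      (\<Sum>u \<in> verts G. if a = u \<and> c = u then count (edges H) {b, d} else 0)"
    by (simp add: mult_def cart_prod_def count_sum
        count_image_times_singleton count_image_singleton_times)
  then show ?thesis using f assms(3-) z
    by (cases "a = c"; cases "b = d") (auto simp: mult_def)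
qed

lemma mgraph_cart_prod: "mgraph G \<Longrightarrow> mgraph H \<Longrightarrow> mgraph (G \<box> H)"
proof -
  assume G: "mgraph G" and H: "mgraph H"
  have "e \<subseteq> verts (G \<box> H) \<and> card e = 2" if "e \<in># edges (G \<box> H)" for e
  proof -
    from that G H consider (1) v f where "v \<in> verts H" "f \<in># edges G" "e = f \<times> {v}"
      | (2) v f where "v \<in> verts G" "f \<in># edges H" "e = {v} \<times> f"
      by (auto simp: cart_prod_def mgraph_def set_mset_sum)
    then show ?thesis
      using G H by cases (auto simp: mgraph_def cart_prod_def card_cartesian_product)
  qed
  then show ?thesis using G H by (auto simp: mgraph_def cart_prod_def)
qed


section \<open>Scramble number\<close>

text \<open>The number of edges between \<open>A\<close> and its complement.\<close>

definition boundary_size :: "'a mgraph \<Rightarrow> 'a set \<Rightarrow> nat" where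
  "boundary_size G A = size {#e \<in># edges G. e \<inter> A \<noteq> {} \<and> e \<inter> (verts G - A) \<noteq> {}#}"

definition scramble :: "'a mgraph \<Rightarrow> 'a set set \<Rightarrow> bool" where
  "scramble G S \<longleftrightarrow> finite S \<and>
     (\<forall>A \<in> S. A \<noteq> {} \<and> A \<subseteq> verts G \<and> connected_graph (induced G A))"

definition hitting_number :: "'a mgraph \<Rightarrow> 'a set set \<Rightarrow> enat" where
  "hitting_number G S = (INF C \<in> {C. C \<subseteq> verts G \<and> (\<forall>A \<in> S. C \<inter> A \<noteq> {})}. enat (card C))"

text \<open>The infimum of the empty set is \<open>\<infinity>\<close>.\<close>

definition egg_cut_number :: "'a mgraph \<Rightarrow> 'a set set \<Rightarrow> enat" where
  "egg_cut_number G S =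
     (INF A \<in> {A. A \<subseteq> verts G \<and> (\<exists>X \<in> S. X \<subseteq> A) \<and> (\<exists>Y \<in> S. Y \<subseteq> verts G - A)}.
        enat (boundary_size G A))"

definition scramble_order :: "'a mgraph \<Rightarrow> 'a set set \<Rightarrow> enat" where
  "scramble_order G S = min (hitting_number G S) (egg_cut_number G S)"

text \<open>The supremum is a maximum, since a finite graph has only finitely many scrambles.\<close>

definition scramble_number :: "'a mgraph \<Rightarrow> enat" where
  "scramble_number G = (SUP S \<in> {S. scramble G S}. scramble_order G S)"


section \<open>Gonality\<close>

definition divisor :: "'a mgraph \<Rightarrow> ('a \<Rightarrow> int) \<Rightarrow> bool" where
  "divisor G D \<longleftrightarrow> (\<forall>v. v \<notin> verts G \<longrightarrow> D v = 0)"

definition deg :: "'a mgraph \<Rightarrow> ('a \<Rightarrow> int) \<Rightarrow> int" where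
  "deg G D = (\<Sum>v \<in> verts G. D v)"

definition effective :: "'a mgraph \<Rightarrow> ('a \<Rightarrow> int) \<Rightarrow> bool" where
  "effective G D \<longleftrightarrow> (\<forall>v \<in> verts G. D v \<ge> 0)"

definition fire :: "'a mgraph \<Rightarrow> 'a \<Rightarrow> ('a \<Rightarrow> int) \<Rightarrow> ('a \<Rightarrow> int)" where
  "fire G w D = (\<lambda>v. if v = w then D v - int (val G w) else D v + int (mult G w v))"

definition lin_equiv :: "'a mgraph \<Rightarrow> ('a \<Rightarrow> int) \<Rightarrow> ('a \<Rightarrow> int) \<Rightarrow> bool" where
  "lin_equiv G = equivclp (\<lambda>D D'. \<exists>w \<in> verts G. D' = fire G w D)"

definition positive_rank :: "'a mgraph \<Rightarrow> ('a \<Rightarrow> int) \<Rightarrow> bool" where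
  "positive_rank G D \<longleftrightarrow>
     (\<forall>v \<in> verts G. \<exists>D'. lin_equiv G (D(v := D v - 1)) D' \<and> effective G D')"

text \<open>On a graph with a vertex, a positive rank divisor has positive degree, so the minimum may be
  taken over the natural numbers.\<close>

definition gonality :: "'a mgraph \<Rightarrow> nat" where
  "gonality G = (LEAST n. \<exists>D. divisor G D \<and> positive_rank G D \<and> deg G D = int n)"

end

theory Submission
  imports Defs
begin

text \<open>The number \<open>n\<close> in question is squeezed by \<open>n \<le> sn \<le> gon \<le> n\<close>.

  The fibres \<open>V(G) \<times> {v}\<close> are disjoint eggs, so hitting them takes \<open>|V(H)|\<close> vertices, and a set
  separating two of them cuts every copy of \<open>H\<close>, so its boundary has at least
  \<open>|V(G)| \<lambda>(H)\<close> edges.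

  For \<open>sn \<le> gon\<close>, take an effective divisor \<open>D\<close> in a positive rank class whose support meets as many
  eggs as possible. If it misses an egg \<open>E\<close>, it can be moved through effective divisors, by firing an
  increasing chain of sets, to one that meets \<open>E\<close>. When \<open>E\<close> is first met it lies outside the fired
  set \<open>U\<close>; by maximality another egg has been lost by then, and it lies inside an earlier fired set,
  hence inside \<open>U\<close>. So \<open>U\<close> separates two eggs, and as firing it is legal, its boundary has at most
  \<open>deg D\<close> edges.

  For the upper bounds, one chip on each vertex of a single copy of \<open>H\<close> can be pushed along the edges
  of a tree \<open>G\<close>, and a positive rank divisor on \<open>H\<close> copied to all copies of \<open>H\<close> has positive rank,
  because firing scripts on a factor lift to the product.\<close>

section \<open>Laplacian and linear equivalence\<close>

text \<open>The net number of chips that \<open>v\<close> loses when every vertex \<open>w\<close>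
  is fired \<open>f w\<close> times; negative values of \<open>f\<close> count inverse
  firings.\<close>

definition laplacian :: "'a mgraph \<Rightarrow> ('a \<Rightarrow> int) \<Rightarrow> 'a \<Rightarrow> int" where
  "laplacian G f v = (\<Sum>w \<in> verts G. int (mult G v w) * (f v - f w))"

lemma mult_commute: "mult G u v = mult G v u"
  by (simp add: mult_def insert_commute)

lemma mult_outside: "mgraph G \<Longrightarrow> v \<notin> verts G \<Longrightarrow> mult G v w = 0"
  by (auto simp: mult_def mgraph_def count_eq_zero_iff)

text \<open>The edge multiset \<open>M\<close> is kept apart from the graph so that induction can
  remove edges while \<open>V\<close> stays fixed. Each crossing edge is counted once, because its
  endpoint in \<open>U\<close> is taken first.\<close>

lemma size_crossing_edges:
  assumes "finite V" "U \<subseteq> V" "\<forall>e \<in># M. e \<subseteq> V \<and> card e = 2"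
  shows "size {#e \<in># M. e \<inter> U \<noteq> {} \<and> e \<inter> (V - U) \<noteq> {}#} = (\<Sum>u\<in>U. \<Sum>w\<in>V - U. count M {u, w})"
  using assms(3)
proof (induction M)
  case empty
  then show ?case by simp
next
  case (add e M)
  have fin: "finite U" "finite (V - U)" using assms finite_subset by auto
  let ?cross = "e \<inter> U \<noteq> {} \<and> e \<inter> (V - U) \<noteq> {}"
  have one: "(\<Sum>u\<in>U. \<Sum>w\<in>V - U. if {u, w} = e then 1 else 0) = (if ?cross then 1 else 0 :: nat)"
  proof (cases ?cross)
    case True
    then obtain a b where ab: "a \<in> U" "b \<in> V - U" "a \<in> e" "b \<in> e" by auto
    have "card e = 2" using add.prems by simp
    then have e: "e = {a, b}" using ab by (auto simp: card_2_iff)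
    have "(\<Sum>u\<in>U. \<Sum>w\<in>V - U. if {u, w} = e then 1 else 0)
        = (\<Sum>u\<in>U. \<Sum>w\<in>V - U. if u = a then (if w = b then 1 else 0) else 0 :: nat)"
      using ab unfolding e by (intro sum.cong refl) (auto simp: doubleton_eq_iff)
    also have "\<dots> = (\<Sum>u\<in>U. if u = a then 1 else 0)"
      using ab fin by (intro sum.cong refl) auto
    also have "\<dots> = 1" using ab fin by auto
    finally show ?thesis using True by simp
  next
    case False
    then have "(\<Sum>u\<in>U. \<Sum>w\<in>V - U. if {u, w} = e then 1 else 0 :: nat) = (\<Sum>u\<in>U. \<Sum>w\<in>V - U. 0)"
      by (intro sum.cong refl) auto
    then show ?thesis using False by simp
  qed
  have "(\<Sum>u\<in>U. \<Sum>w\<in>V - U. count (add_mset e M) {u, w})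
      = (\<Sum>u\<in>U. \<Sum>w\<in>V - U. count M {u, w} + (if {u, w} = e then 1 else 0))"
    by (intro sum.cong refl) auto
  also have "\<dots> = (\<Sum>u\<in>U. \<Sum>w\<in>V - U. count M {u, w}) + (if ?cross then 1 else 0)"
    unfolding one[symmetric] by (simp only: sum.distrib)
  finally show ?case using add by simp
qed

lemma boundary_size_eq_sum:
  "mgraph G \<Longrightarrow> U \<subseteq> verts G \<Longrightarrow>
   boundary_size G U = (\<Sum>u\<in>U. \<Sum>w\<in>verts G - U. mult G u w)"
  unfolding boundary_size_def mult_def by (rule size_crossing_edges) (auto simp: mgraph_def)

text \<open>Without loops, the edges at \<open>v\<close> are exactly those crossing
  \<open>{v}\<close>.\<close>

lemma val_eq_sum:
  assumes "mgraph G" "v \<in> verts G"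
  shows "val G v = (\<Sum>w\<in>verts G - {v}. mult G v w)"
proof -
  have "val G v = boundary_size G {v}"
    unfolding val_def boundary_size_def
  proof (intro arg_cong[of _ _ size] filter_mset_cong refl)
    fix e assume "e \<in># edges G"
    then have "e \<subseteq> verts G" "card e = 2" using assms by (auto simp: mgraph_def)
    then show "v \<in> e \<longleftrightarrow> e \<inter> {v} \<noteq> {} \<and> e \<inter> (verts G - {v}) \<noteq> {}"
      by (auto simp: card_2_iff)
  qed
  then show ?thesis using assms by (simp add: boundary_size_eq_sum)
qed

lemma laplacian_add: "laplacian G (\<lambda>v. f v + g v) v = laplacian G f v + laplacian G g v"
  unfolding laplacian_def sum.distrib[symmetric] by (intro sum.cong refl) (simp add: algebra_simps)

lemma laplacian_minus: "laplacian G (\<lambda>v. - f v) v = - laplacian G f v"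
  unfolding laplacian_def sum_negf[symmetric] by (intro sum.cong refl) (simp add: algebra_simps)

lemma laplacian_const: "laplacian G (\<lambda>v. c) v = 0"
  by (simp add: laplacian_def)

lemma laplacian_outside: "mgraph G \<Longrightarrow> v \<notin> verts G \<Longrightarrow> laplacian G f v = 0"
  by (simp add: laplacian_def mult_outside)

lemma laplacian_cong:
  assumes "mgraph G" "\<And>v. v \<in> verts G \<Longrightarrow> f v = g v"
  shows "laplacian G f v = laplacian G g v"
proof (cases "v \<in> verts G")
  case True
  then show ?thesis using assms by (auto simp: laplacian_def intro!: sum.cong)
qed (use assms in \<open>simp add: laplacian_outside\<close>)

lemma laplacian_shift: "laplacian G (\<lambda>v. f v + c) v = laplacian G f v"
  by (simp add: laplacian_def)

text \<open>The summand is antisymmetric in its two vertices, so swapping the sums shows the total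
  equal to its own negative. Hence firing preserves degree.\<close>

lemma laplacian_sum_zero: "(\<Sum>v\<in>verts G. laplacian G f v) = 0"
proof -
  let ?s = "\<lambda>v w. int (mult G v w) * (f v - f w)"
  have "(\<Sum>v\<in>verts G. laplacian G f v) = (\<Sum>w\<in>verts G. \<Sum>v\<in>verts G. ?s v w)"
    unfolding laplacian_def by (rule sum.swap)
  also have "\<dots> = (\<Sum>w\<in>verts G. \<Sum>v\<in>verts G. - ?s w v)"
    by (intro sum.cong refl) (simp add: mult_commute[of G] algebra_simps)
  also have "\<dots> = - (\<Sum>v\<in>verts G. laplacian G f v)"
    by (simp add: laplacian_def sum_negf)
  finally show ?thesis by simp
qed

lemma deg_laplacian: "deg G (\<lambda>v. D v - laplacian G f v) = deg G D"
  by (simp add: deg_def sum_subtractf laplacian_sum_zero)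

lemma laplacian_nonneg:
  "(\<And>w. w \<in> verts G \<Longrightarrow> f w \<le> f v) \<Longrightarrow> 0 \<le> laplacian G f v"
  by (auto simp: laplacian_def intro!: sum_nonneg)

lemma laplacian_nonpos:
  "(\<And>w. w \<in> verts G \<Longrightarrow> f v \<le> f w) \<Longrightarrow> laplacian G f v \<le> 0"
  by (auto simp: laplacian_def mult_nonneg_nonpos intro!: sum_nonpos)

lemma fire_eq_laplacian:
  assumes "mgraph G" "w \<in> verts G"
  shows "fire G w D = (\<lambda>v. D v - laplacian G (\<lambda>x. of_bool (x = w)) v)"
proof
  have fin: "finite (verts G)" using assms by (simp add: mgraph_def)
  fix v show "fire G w D v = D v - laplacian G (\<lambda>x. of_bool (x = w)) v"
  proof (cases "v = w")
    case True
    have "laplacian G (\<lambda>x. of_bool (x = w)) w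
        = (\<Sum>x\<in>verts G - {w}. int (mult G w x) * (1 - of_bool (x = w)))"
      unfolding laplacian_def using fin assms by (simp add: sum.remove[of _ w])
    also have "\<dots> = int (val G w)"
      using assms by (auto simp: val_eq_sum intro!: sum.cong)
    finally show ?thesis using True by (simp add: fire_def)
  next
    case False
    have "laplacian G (\<lambda>x. of_bool (x = w)) v
        = (\<Sum>x\<in>verts G. if x = w then - int (mult G v w) else 0)"
      unfolding laplacian_def using False by (intro sum.cong refl) auto
    also have "\<dots> = - int (mult G v w)" using fin assms by simp
    finally show ?thesis using False by (simp add: fire_def mult_commute)
  qed
qed

section \<open>Linear equivalence as subtraction of a Laplacian\<close>

lemma lin_equiv_sym: "lin_equiv G D D' \<Longrightarrow> lin_equiv G D' D"
  unfolding lin_equiv_def by (rule equivclp_sym)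

lemma lin_equiv_trans: "lin_equiv G D D' \<Longrightarrow> lin_equiv G D' D'' \<Longrightarrow> lin_equiv G D D''"
  unfolding lin_equiv_def by (rule equivclp_trans)

text \<open>The scripts that act as equivalences are closed under sums and negation and contain the
  indicator of every vertex, so they contain every integer script.\<close>

lemma lin_equiv_sub_laplacian:
  assumes G: "mgraph G"
  shows "lin_equiv G D (\<lambda>v. D v - laplacian G f v)"
proof -
  \<comment> \<open>Quantifying over all \<open>D\<close> lets two scripts in \<open>L\<close> be
    applied one after the other.\<close>
  define L where "L = {f. \<forall>D. lin_equiv G D (\<lambda>v. D v - laplacian G f v)}"
  have plus: "(\<lambda>v. f v + g v) \<in> L" if "f \<in> L" "g \<in> L" for f g
  proof -
    have "lin_equiv G D (\<lambda>v. (D v - laplacian G f v) - laplacian G g v)" for D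
      using that lin_equiv_trans unfolding L_def by blast
    then show ?thesis by (simp add: L_def laplacian_add algebra_simps)
  qed
  have uminus: "(\<lambda>v. - f v) \<in> L" if "f \<in> L" for f
  proof -
    have "lin_equiv G (\<lambda>v. D v + laplacian G f v) (\<lambda>v. (D v + laplacian G f v) - laplacian G f v)" for D
      using that unfolding L_def by blast
    then show ?thesis by (simp add: L_def laplacian_minus lin_equiv_sym)
  qed
  have zero: "(\<lambda>v. 0) \<in> L"
    by (simp add: L_def laplacian_const lin_equiv_def)
  have scale: "(\<lambda>v. c * g v) \<in> L" if "g \<in> L" for g c
  proof (induction c rule: int_induct[where k = 0])
    case base
    then show ?case using zero by simp
  next
    case (step1 i)
    then show ?case using plus[OF step1(2) that] by (simp add: algebra_simps)
  next
    case (step2 i)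
    then show ?case using plus[OF step2(2) uminus[OF that]] by (simp add: algebra_simps)
  qed
  have single: "(\<lambda>x. of_bool (x = w)) \<in> L" if w: "w \<in> verts G" for w
  proof -
    have "lin_equiv G D (fire G w D)" for D
      unfolding lin_equiv_def using w by (intro r_into_equivclp) auto
    then show ?thesis by (simp add: L_def fire_eq_laplacian[OF G w])
  qed
  have "(\<lambda>x. \<Sum>w\<in>W. f w * of_bool (x = w)) \<in> L" if "finite W" "W \<subseteq> verts G" for W
    using that
  proof (induction W)
    case empty
    then show ?case using zero by simp
  next
    case (insert w W)
    then have "(\<lambda>x. f w * of_bool (x = w) + (\<Sum>w\<in>W. f w * of_bool (x = w))) \<in> L"
      by (intro plus scale single) auto
    then show ?case using insert(1,2) by (simp only: sum.insert not_False_eq_True)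
  qed
  moreover have fin: "finite (verts G)" using G by (simp add: mgraph_def)
  ultimately have "(\<lambda>x. \<Sum>w\<in>verts G. f w * of_bool (x = w)) \<in> L" by simp
  moreover have "laplacian G (\<lambda>x. \<Sum>w\<in>verts G. f w * of_bool (x = w)) v = laplacian G f v" for v
    using fin by (intro laplacian_cong[OF G]) simp
  ultimately show ?thesis by (simp add: L_def)
qed

lemma lin_equiv_iff:
  assumes G: "mgraph G"
  shows "lin_equiv G D D' \<longleftrightarrow> (\<exists>f. D' = (\<lambda>v. D v - laplacian G f v))"
proof
  assume "lin_equiv G D D'"
  then show "\<exists>f. D' = (\<lambda>v. D v - laplacian G f v)"
    unfolding lin_equiv_def
  proof (induction rule: equivclp_induct)
    case base
    show ?case by (intro exI[of _ "\<lambda>_. 0"]) (simp add: laplacian_const)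
  next
    case (step y z)
    then obtain f where f: "y = (\<lambda>v. D v - laplacian G f v)" by blast
    from step(2) obtain w where w: "w \<in> verts G" "z = fire G w y \<or> y = fire G w z" by auto
    let ?g = "\<lambda>x. of_bool (x = w) :: int"
    from w(2) show ?case
    proof
      assume "z = fire G w y"
      then show ?thesis unfolding fire_eq_laplacian[OF G w(1)] f
        by (intro exI[of _ "\<lambda>x. f x + ?g x"]) (simp add: laplacian_add algebra_simps)
    next
      assume "y = fire G w z"
      then have "z = (\<lambda>v. y v + laplacian G ?g v)"
        unfolding fire_eq_laplacian[OF G w(1)] by simp
      then show ?thesis unfolding f
        by (intro exI[of _ "\<lambda>x. f x + - ?g x"]) (simp only: laplacian_add laplacian_minus, simp add: algebra_simps)
    qed
  qed
next
  assume "\<exists>f. D' = (\<lambda>v. D v - laplacian G f v)"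
  then show "lin_equiv G D D'" using lin_equiv_sub_laplacian[OF G] by blast
qed

text \<open>Moving the subtracted chip to the other side leaves \<open>D\<close> fixed: some divisor
  equivalent to \<open>D\<close> is effective and has a chip on \<open>v\<close>, both expressed by
  one inequality.\<close>

lemma positive_rank_iff:
  assumes "mgraph G"
  shows "positive_rank G D \<longleftrightarrow>
    (\<forall>v\<in>verts G. \<exists>f. \<forall>w\<in>verts G. of_bool (w = v) \<le> D w - laplacian G f w)"
proof -
  have "effective G (\<lambda>w. (D(v := D v - 1)) w - laplacian G f w) \<longleftrightarrow>
     (\<forall>w\<in>verts G. of_bool (w = v) \<le> D w - laplacian G f w)" for v f
    by (auto simp: effective_def)
  then have "(\<exists>D'. lin_equiv G (D(v := D v - 1)) D' \<and> effective G D') \<longleftrightarrow>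
     (\<exists>f. \<forall>w\<in>verts G. of_bool (w = v) \<le> D w - laplacian G f w)" for v
    unfolding lin_equiv_iff[OF assms] by blast
  then show ?thesis unfolding positive_rank_def by simp
qed


section \<open>Scramble number is a lower bound for gonality\<close>

lemma rtranclp_leaves_set:
  assumes "R\<^sup>*\<^sup>* x y" "x \<in> U" "y \<notin> U"
  shows "\<exists>a b. R a b \<and> a \<in> U \<and> b \<notin> U"
  using assms by (induction rule: rtranclp_induct) blast+

lemma connected_induced_crossing:
  assumes "connected_graph (induced G A)" "A \<inter> U \<noteq> {}" "\<not> A \<subseteq> U"
  shows "\<exists>a b. a \<in> A \<inter> U \<and> b \<in> A - U \<and> 0 < mult G a b"
proof -
  obtain x y where xy: "x \<in> A" "x \<in> U" "y \<in> A" "y \<notin> U" using assms by blast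
  then have "(adjacent (induced G A))\<^sup>*\<^sup>* x y"
    using assms by (auto simp: connected_graph_def induced_def)
  then obtain a b where "adjacent (induced G A) a b" "a \<in> U" "b \<notin> U"
    using rtranclp_leaves_set[OF _ xy(2,4)] by blast
  then show ?thesis by (auto simp: adjacent_def induced_def mult_def)
qed

lemma laplacian_indicator_outside:
  assumes "finite (verts G)" "U \<subseteq> verts G" "b \<notin> U"
  shows "laplacian G (\<lambda>v. of_bool (v \<in> U)) b = - (\<Sum>u\<in>U. int (mult G b u))"
proof -
  have "laplacian G (\<lambda>v. of_bool (v \<in> U)) b
      = (\<Sum>w\<in>verts G. if w \<in> U then - int (mult G b w) else 0)"
    unfolding laplacian_def using assms by (intro sum.cong refl) auto
  also have "\<dots> = (\<Sum>w\<in>verts G \<inter> U. - int (mult G b w))"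
    using assms(1) by (simp add: sum.inter_restrict)
  also have "verts G \<inter> U = U" using assms by blast
  finally show ?thesis by (simp add: sum_negf)
qed

lemma laplacian_indicator_inside:
  assumes "finite (verts G)" "a \<in> U"
  shows "laplacian G (\<lambda>v. of_bool (v \<in> U)) a = (\<Sum>w\<in>verts G - U. int (mult G a w))"
proof -
  have "laplacian G (\<lambda>v. of_bool (v \<in> U)) a
      = (\<Sum>w\<in>verts G. if w \<in> - U then int (mult G a w) else 0)"
    unfolding laplacian_def using assms by (intro sum.cong refl) auto
  also have "\<dots> = (\<Sum>w\<in>verts G \<inter> - U. int (mult G a w))"
    using assms(1) by (simp add: sum.inter_restrict)
  finally show ?thesis by (simp add: Diff_eq)
qed

text \<open>Vertices of \<open>A\<close> outside \<open>U\<close> only gain chips, so the chip at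
  \<open>a\<close> can be lost only if \<open>A\<close> meets \<open>U\<close>. If \<open>A\<close>
  also left \<open>U\<close>, connectedness would give an edge of \<open>A\<close> across the
  border, and its outer end would hold a chip after the firing.\<close>

lemma firing_loses_egg:
  assumes G: "mgraph G" and "U \<subseteq> verts G" "A \<subseteq> verts G"
    and conn: "connected_graph (induced G A)"
    and eff: "effective G D"
    and hit: "a \<in> A" "0 < D a"
    and unhit: "\<And>b. b \<in> A \<Longrightarrow> D b - laplacian G (\<lambda>v. of_bool (v \<in> U)) b \<le> 0"
  shows "A \<subseteq> U"
proof (rule ccontr)
  assume nsub: "\<not> A \<subseteq> U"
  have fin: "finite (verts G)" "finite U" using assms by (auto simp: mgraph_def dest: finite_subset)
  have gain: "D b + (\<Sum>u\<in>U. int (mult G b u)) \<le> 0" if "b \<in> A - U" for b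
    using unhit[of b] that laplacian_indicator_outside[OF fin(1) assms(2), of b] by auto
  have "A \<inter> U \<noteq> {}"
  proof
    assume "A \<inter> U = {}"
    then have "D a + (\<Sum>u\<in>U. int (mult G a u)) \<le> 0" using gain hit by blast
    moreover have "0 \<le> (\<Sum>u\<in>U. int (mult G a u))" by (simp add: sum_nonneg)
    ultimately show False using hit by linarith
  qed
  then obtain c b where cb: "c \<in> A \<inter> U" "b \<in> A - U" "0 < mult G c b"
    using connected_induced_crossing[OF conn _ nsub] by blast
  have "int (mult G b c) \<le> (\<Sum>u\<in>U. int (mult G b u))"
    using cb fin by (intro member_le_sum) auto
  moreover have "0 < int (mult G b c)" using cb mult_commute[of G b c] by simp
  moreover have "0 \<le> D b" using eff cb assms(3) by (auto simp: effective_def)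
  ultimately show False using gain[OF cb(2)] by linarith
qed

text \<open>The vertices of \<open>U\<close> together send one chip along each boundary edge, and
  effectivity after the firing means that they held these chips before.\<close>

lemma boundary_size_le_deg:
  assumes G: "mgraph G" and U: "U \<subseteq> verts G" and eff: "effective G D"
    and eff': "effective G (\<lambda>v. D v - laplacian G (\<lambda>v. of_bool (v \<in> U)) v)"
  shows "int (boundary_size G U) \<le> deg G D"
proof -
  have fin: "finite (verts G)" using G by (simp add: mgraph_def)
  have "int (boundary_size G U) = (\<Sum>u\<in>U. laplacian G (\<lambda>v. of_bool (v \<in> U)) u)"
    using fin by (simp add: boundary_size_eq_sum[OF G U] laplacian_indicator_inside)
  also have "\<dots> \<le> (\<Sum>u\<in>U. D u)"
    using eff' U by (intro sum_mono) (auto simp: effective_def)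
  also have "\<dots> \<le> (\<Sum>u\<in>verts G. D u)"
    using fin U eff by (intro sum_mono2) (auto simp: effective_def)
  finally show ?thesis by (simp add: deg_def)
qed

text \<open>Truncating a firing script at any level keeps the divisor effective: below the level a
  vertex only gains chips from the start, above it a vertex only loses chips until the end.\<close>

lemma effective_truncated_script:
  assumes G: "mgraph G" and eff: "effective G D"
    and eff': "effective G (\<lambda>v. D v - laplacian G f v)"
  shows "effective G (\<lambda>v. D v - laplacian G (\<lambda>x. max (f x - c) 0) v)"
  unfolding effective_def
proof
  fix v assume v: "v \<in> verts G"
  show "0 \<le> D v - laplacian G (\<lambda>x. max (f x - c) 0) v"
  proof (cases "f v \<le> c")
    case True
    then have "laplacian G (\<lambda>x. max (f x - c) 0) v \<le> 0" by (intro laplacian_nonpos) auto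
    moreover have "0 \<le> D v" using eff v by (auto simp: effective_def)
    ultimately show ?thesis by linarith
  next
    case False
    have "f = (\<lambda>x. max (f x - c) 0 + min (f x) c)" by auto
    then have "laplacian G f v = laplacian G (\<lambda>x. max (f x - c) 0) v + laplacian G (\<lambda>x. min (f x) c) v"
      using laplacian_add[of G "\<lambda>x. max (f x - c) 0" "\<lambda>x. min (f x) c" v] by simp
    moreover have "0 \<le> laplacian G (\<lambda>x. min (f x) c) v"
      using False by (intro laplacian_nonneg) auto
    moreover have "0 \<le> D v - laplacian G f v" using eff' v by (auto simp: effective_def)
    ultimately show ?thesis by linarith
  qed
qed

lemma first_success:
  assumes "\<not> P 0" "P (N::nat)"
  obtains k where "k < N" "\<not> P k" "P (Suc k)"
proof -
  define m where "m = (LEAST k. P k)"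
  have "P m" "m \<le> N"
    unfolding m_def using assms(2) by (rule LeastI, rule Least_le)
  moreover from this obtain k where "m = Suc k" using assms(1) by (cases m) auto
  moreover from this have "\<not> P k" unfolding m_def by (intro not_less_Least) simp
  ultimately show ?thesis using that[of k] by simp
qed

lemma scramble_order_le_deg:
  assumes G: "mgraph G" and ne: "verts G \<noteq> {}" and S: "scramble G S" and pr: "positive_rank G D\<^sub>0"
    and n: "deg G D\<^sub>0 = int n"
  shows "scramble_order G S \<le> enat n"
proof (rule ccontr)
  assume "\<not> scramble_order G S \<le> enat n"
  then have hn: "\<not> hitting_number G S \<le> enat n" and en: "\<not> egg_cut_number G S \<le> enat n"
    by (auto simp: scramble_order_def min_le_iff_disj)
  have fin: "finite (verts G)" using G by (simp add: mgraph_def)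
  have finS: "finite S" using S by (simp add: scramble_def)
  have egg: "A \<noteq> {} \<and> A \<subseteq> verts G \<and> connected_graph (induced G A)" if "A \<in> S" for A
    using S that by (simp add: scramble_def)
  define Dv where "Dv f v = D\<^sub>0 v - laplacian G f v" for f v
  define hits where "hits D = {A \<in> S. \<exists>a\<in>A. 0 < D a}" for D :: "'a \<Rightarrow> int"
  have finh: "finite (hits D)" for D using finS by (simp add: hits_def)
  have reach: "\<exists>f. \<forall>w\<in>verts G. of_bool (w = v) \<le> Dv f w" if "v \<in> verts G" for v
    using pr that unfolding positive_rank_iff[OF G] Dv_def by blast
  have degDv: "deg G (Dv f) = int n" for f
    using n deg_laplacian[of G D\<^sub>0 f] unfolding Dv_def by simp
  have effDv: "effective G (Dv f)" if "\<forall>w\<in>verts G. of_bool (w = v) \<le> Dv f w" for f v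
    unfolding effective_def
  proof
    fix w assume "w \<in> verts G"
    then have "of_bool (w = v) \<le> Dv f w" using that by blast
    then show "0 \<le> Dv f w" by (cases "w = v") auto
  qed
  \<comment> \<open>The number of eggs hit is at most \<open>card S\<close>, so a maximum exists;
    \<open>Suc (card S)\<close> provides the strict bound required by
    \<open>ex_has_greatest_nat\<close>.\<close>
  have "\<exists>f. effective G (Dv f) \<and> (\<forall>g. effective G (Dv g) \<longrightarrow> card (hits (Dv g)) \<le> card (hits (Dv f)))"
  proof -
    obtain f0 where f0: "effective G (Dv f0)" using ne reach effDv by blast
    have "\<forall>g. effective G (Dv g) \<longrightarrow> card (hits (Dv g)) \<le> card S"
      using finS by (auto simp: hits_def intro!: card_mono)
    then show ?thesis
      using ex_has_greatest_nat[of "\<lambda>f. effective G (Dv f)" f0 "\<lambda>f. card (hits (Dv f))" "Suc (card S)"] f0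
      by (auto simp: less_Suc_eq_le)
  qed
  then obtain f\<^sub>0 where f0: "effective G (Dv f\<^sub>0)"
    and maxi: "\<And>g. effective G (Dv g) \<Longrightarrow> card (hits (Dv g)) \<le> card (hits (Dv f\<^sub>0))" by blast
  define D where "D = Dv f\<^sub>0"
  have effD: "effective G D" using f0 D_def by simp
  have Dv_shift: "Dv g = (\<lambda>v. D v - laplacian G (\<lambda>x. g x + - f\<^sub>0 x) v)" for g
    unfolding D_def Dv_def laplacian_add laplacian_minus by auto
  have maxD: "card (hits D') \<le> card (hits D)"
    if "effective G D'" "D' = (\<lambda>v. D v - laplacian G g v)" for D' g
  proof -
    have "D' = Dv (\<lambda>x. f\<^sub>0 x + g x)" unfolding that D_def Dv_def laplacian_add by auto
    then show ?thesis using maxi that unfolding D_def by simp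
  qed
  have degD: "deg G D = int n" using degDv D_def by simp
  \<comment> \<open>The support of \<open>D\<close> has at most \<open>n\<close> vertices, which is
    too few to hit every egg.\<close>
  obtain E where E: "E \<in> S" "E \<notin> hits D"
  proof -
    let ?C = "{v \<in> verts G. 0 < D v}"
    have "int (card ?C) = (\<Sum>v\<in>?C. 1)" by simp
    also have "\<dots> \<le> (\<Sum>v\<in>?C. D v)" by (intro sum_mono) auto
    also have "\<dots> \<le> deg G D" unfolding deg_def
      using fin effD by (intro sum_mono2) (auto simp: effective_def)
    finally have "enat (card ?C) \<le> enat n" using degD by simp
    then have not_le: "\<not> hitting_number G S \<le> enat (card ?C)" using hn order_trans by blast
    have "hitting_number G S \<le> enat (card ?C)" if "\<forall>A\<in>S. ?C \<inter> A \<noteq> {}"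
      unfolding hitting_number_def using that by (intro INF_lower) blast
    then obtain A where A: "A \<in> S" "?C \<inter> A = {}" using not_le by blast
    then have "A \<notin> hits D" using egg[OF A(1)] by (auto simp: hits_def)
    then show ?thesis using that A by blast
  qed
  obtain v where v: "v \<in> E" "v \<in> verts G" using egg[OF E(1)] by blast
  obtain g where g: "\<forall>w\<in>verts G. of_bool (w = v) \<le> Dv g w" using reach[OF v(2)] by blast
  \<comment> \<open>The script leading from \<open>D\<close> to a divisor with a chip on the vertex
    \<open>v\<close> of the missed egg.\<close>
  define f where "f x = g x + - f\<^sub>0 x" for x
  have Dg: "Dv g = (\<lambda>v. D v - laplacian G f v)" unfolding Dv_shift f_def ..
  have efff: "effective G (\<lambda>v. D v - laplacian G f v)" using effDv[OF g] Dg by simp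
  \<comment> \<open>Truncating \<open>f\<close> at level \<open>M - k\<close> gives the zero script
    for \<open>k = 0\<close> and, on the vertices, \<open>f\<close> up to a constant for
    \<open>k = N\<close>.\<close>
  define M where "M = Max (f ` verts G)"
  define N where "N = nat (M - Min (f ` verts G))"
  have fb: "M - int N \<le> f x \<and> f x \<le> M" if "x \<in> verts G" for x
  proof -
    have "Min (f ` verts G) \<le> f x" "f x \<le> M" using that fin by (auto simp: M_def)
    then show ?thesis by (simp add: N_def)
  qed
  define Dn where "Dn k v = D v - laplacian G (\<lambda>x. max (f x - (M - int k)) 0) v" for k v
  have effn: "effective G (Dn k)" for k
    unfolding Dn_def by (rule effective_truncated_script[OF G effD efff])
  have D0: "Dn 0 = D"
  proof
    fix v
    have "laplacian G (\<lambda>x. max (f x - (M - int 0)) 0) v = laplacian G (\<lambda>x. 0) v"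
      using fb by (intro laplacian_cong[OF G]) auto
    then show "Dn 0 v = D v" by (simp add: Dn_def laplacian_const)
  qed
  have DN: "Dn N = Dv g"
  proof
    fix v
    have "laplacian G (\<lambda>x. max (f x - (M - int N)) 0) v = laplacian G (\<lambda>x. f x + - (M - int N)) v"
      using fb by (intro laplacian_cong[OF G]) auto
    also have "\<dots> = laplacian G f v" by (rule laplacian_shift)
    finally show "Dn N v = Dv g v" by (simp add: Dn_def Dg)
  qed
  \<comment> \<open>Lowering the truncation level by one raises the truncated script by one exactly
    on \<open>U k\<close>, so \<open>Dn (Suc k)\<close> arises from \<open>Dn k\<close> by firing
    \<open>U k\<close>.\<close>
  define U where "U k = {x \<in> verts G. M - int k \<le> f x}" for k
  have U: "U k \<subseteq> verts G" for k by (auto simp: U_def)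
  have Usub: "U j \<subseteq> U k" if "j \<le> k" for j k using that by (auto simp: U_def)
  have step: "Dn (Suc k) v = Dn k v - laplacian G (\<lambda>x. of_bool (x \<in> U k)) v" for k v
  proof -
    have "laplacian G (\<lambda>x. max (f x - (M - int (Suc k))) 0) v
        = laplacian G (\<lambda>x. max (f x - (M - int k)) 0 + of_bool (x \<in> U k)) v"
      by (intro laplacian_cong[OF G]) (auto simp: U_def)
    then show ?thesis by (simp only: Dn_def laplacian_add)
  qed
  have loses: "A \<subseteq> U k" if A_hit: "A \<in> hits (Dn k)" and A_unhit: "A \<notin> hits (Dn (Suc k))" for A k
  proof -
    have A: "A \<in> S" using A_hit by (simp add: hits_def)
    obtain a where a: "a \<in> A" "0 < Dn k a" using A_hit by (auto simp: hits_def)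
    have "Dn (Suc k) b \<le> 0" if "b \<in> A" for b
      using A_unhit A that by (auto simp: hits_def not_less)
    then show ?thesis
      using firing_loses_egg[OF G U _ _ effn a, of k] egg[OF A] step by simp
  qed
  \<comment> \<open>Firing the complement of \<open>U k\<close> undoes the firing of
    \<open>U k\<close>, so an egg gained in this step is an egg lost in the reversed step.\<close>
  have gains: "A \<subseteq> verts G - U k" if A_unhit: "A \<notin> hits (Dn k)" and A_hit: "A \<in> hits (Dn (Suc k))" for A k
  proof -
    have A: "A \<in> S" using A_hit by (simp add: hits_def)
    obtain a where a: "a \<in> A" "0 < Dn (Suc k) a" using A_hit by (auto simp: hits_def)
    have undo: "Dn (Suc k) b - laplacian G (\<lambda>x. of_bool (x \<in> verts G - U k)) b = Dn k b" for b
    proof -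
      have "laplacian G (\<lambda>x. of_bool (x \<in> verts G - U k)) b
          = laplacian G (\<lambda>x. - of_bool (x \<in> U k) + 1) b"
        by (intro laplacian_cong[OF G]) (auto simp: U_def)
      also have "\<dots> = - laplacian G (\<lambda>x. of_bool (x \<in> U k)) b"
        by (simp only: laplacian_shift laplacian_minus)
      finally show ?thesis by (simp add: step)
    qed
    have "Dn (Suc k) b - laplacian G (\<lambda>x. of_bool (x \<in> verts G - U k)) b \<le> 0" if "b \<in> A" for b
      unfolding undo using A_unhit A that by (auto simp: hits_def not_less)
    then show ?thesis
      using firing_loses_egg[OF G _ _ _ effn a, of "verts G - U k"] egg[OF A] by blast
  qed
  have "E \<in> hits (Dn N)" using g v E(1) unfolding DN hits_def by force
  then obtain k where k: "E \<notin> hits (Dn k)" "E \<in> hits (Dn (Suc k))"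
    using first_success[of "\<lambda>k. E \<in> hits (Dn k)" N] E(2) unfolding D0 by blast
  \<comment> \<open>Since \<open>E\<close> is newly hit, keeping all eggs hit by \<open>D\<close>
    would exceed the maximum; so some \<open>E'\<close> has been lost, at a step \<open>j\<close> no
    later than \<open>k\<close>.\<close>
  have "card (hits (Dn (Suc k))) \<le> card (hits D)"
    by (rule maxD[OF effn]) (auto simp: Dn_def)
  then have "\<not> hits D \<subset> hits (Dn (Suc k))" using psubset_card_mono[OF finh] by (meson not_le)
  then obtain E' where E': "E' \<in> hits D" "E' \<notin> hits (Dn (Suc k))" using k(2) E(2) by blast
  then obtain j where j: "j < Suc k" "E' \<in> hits (Dn j)" "E' \<notin> hits (Dn (Suc j))"
    using first_success[of "\<lambda>k. E' \<notin> hits (Dn k)" "Suc k"] unfolding D0 by blast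
  have sub: "E' \<subseteq> U k" using loses[OF j(2,3)] Usub[of j k] j(1) by auto
  have "E' \<in> S" using E' by (simp add: hits_def)
  then have "egg_cut_number G S \<le> enat (boundary_size G (U k))"
    unfolding egg_cut_number_def using sub U gains[OF k] E(1) by (intro INF_lower) auto
  also have "int (boundary_size G (U k)) \<le> deg G (Dn k)"
    by (rule boundary_size_le_deg[OF G U effn]) (use effn[of "Suc k"] in \<open>simp add: step[abs_def]\<close>)
  then have "enat (boundary_size G (U k)) \<le> enat n"
    using degD deg_laplacian[of G D] by (simp add: Dn_def[abs_def])
  finally show False using en by simp
qed

text \<open>Witness that positive rank divisors of natural degree exist, so that the
  \<open>LEAST\<close> in \<open>gonality\<close> is attained.\<close>

lemma positive_rank_one:
  assumes "mgraph G"
  shows "positive_rank G (\<lambda>v. of_bool (v \<in> verts G))"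
  unfolding positive_rank_iff[OF assms]
  by (intro ballI exI[of _ "\<lambda>_. 0"]) (auto simp: laplacian_const)

lemma gonality_attained:
  assumes "mgraph G"
  obtains D where "divisor G D" "positive_rank G D" "deg G D = int (gonality G)"
proof -
  have "divisor G (\<lambda>v. of_bool (v \<in> verts G))" "deg G (\<lambda>v. of_bool (v \<in> verts G)) = int (card (verts G))"
    by (auto simp: divisor_def deg_def)
  then have "\<exists>n D. divisor G D \<and> positive_rank G D \<and> deg G D = int n"
    using positive_rank_one[OF assms] by blast
  then have "\<exists>D. divisor G D \<and> positive_rank G D \<and> deg G D = int (gonality G)"
    unfolding gonality_def by (rule LeastI_ex)
  then show ?thesis using that by blast
qed

lemma gonality_le:
  "divisor G D \<Longrightarrow> positive_rank G D \<Longrightarrow> deg G D = int n \<Longrightarrow> gonality G \<le> n"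
  unfolding gonality_def by (rule Least_le) blast

theorem scramble_number_le_gonality:
  assumes "mgraph G" "verts G \<noteq> {}"
  shows "scramble_number G \<le> enat (gonality G)"
proof -
  obtain D where "positive_rank G D" "deg G D = int (gonality G)"
    using gonality_attained[OF assms(1)] by blast
  then show ?thesis
    unfolding scramble_number_def using scramble_order_le_deg[OF assms] by (auto intro: SUP_least)
qed


section \<open>Edge connectivity and the scramble of fibres\<close>

text \<open>Deleting all edges across \<open>B\<close> disconnects the graph, since a path leaving
  \<open>B\<close> must use one of them.\<close>

lemma edge_connectivity_le_boundary_size:
  assumes G: "mgraph G" and B: "B \<subseteq> verts G" "B \<noteq> {}" "B \<noteq> verts G"
  shows "edge_connectivity G \<le> boundary_size G B"
proof -
  let ?F = "{#e \<in># edges G. e \<inter> B \<noteq> {} \<and> e \<inter> (verts G - B) \<noteq> {}#}"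
  let ?H = "Mgraph (verts G) (edges G - ?F)"
  have "\<not> connected_graph ?H"
  proof
    assume conn: "connected_graph ?H"
    obtain x y where xy: "x \<in> B" "y \<in> verts G - B" using B by blast
    then have "(adjacent ?H)\<^sup>*\<^sup>* x y" using conn B by (auto simp: connected_graph_def)
    then obtain a b where ab: "adjacent ?H a b" "a \<in> B" "b \<notin> B"
      using rtranclp_leaves_set[of _ x y B] xy by blast
    then have in_diff: "{a, b} \<in># edges G - ?F" by (simp add: adjacent_def)
    then have "{a, b} \<in># edges G" by (rule in_diffD)
    then have "b \<in> verts G" using G by (auto simp: mgraph_def)
    then have "count (edges G - ?F) {a, b} = 0" using ab by auto
    then have "{a, b} \<notin># edges G - ?F" unfolding count_eq_zero_iff .
    with in_diff show False by blast
  qed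
  then have "\<exists>F. F \<subseteq># edges G \<and> size F = boundary_size G B \<and>
      \<not> connected_graph (Mgraph (verts G) (edges G - F))"
    by (intro exI[of _ ?F]) (simp add: boundary_size_def)
  then show ?thesis unfolding edge_connectivity_def by (auto intro: Least_le)
qed

text \<open>With two vertices, deleting all edges disconnects, so the minimum is attained. If it
  were 0, deleting nothing would disconnect a connected graph.\<close>

lemma edge_connectivity_pos:
  assumes G: "mgraph G" "connected_graph G" and card: "2 \<le> card (verts G)"
  shows "0 < edge_connectivity G"
proof (rule ccontr)
  let ?P = "\<lambda>k. \<exists>F. F \<subseteq># edges G \<and> size F = k \<and> \<not> connected_graph (Mgraph (verts G) (edges G - F))"
  assume "\<not> 0 < edge_connectivity G"
  then have L: "(LEAST k. ?P k) = 0" using card by (simp add: edge_connectivity_def)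
  obtain x y where "x \<in> verts G" "y \<in> verts G" "x \<noteq> y"
    using card by (metis card_le_Suc_iff insertCI numeral_2_eq_2)
  moreover from \<open>x \<noteq> y\<close> have "\<not> (adjacent (Mgraph (verts G) {#}))\<^sup>*\<^sup>* x y"
    by (auto simp: adjacent_def elim: converse_rtranclpE)
  ultimately have "\<not> connected_graph (Mgraph (verts G) (edges G - edges G))"
    by (auto simp: connected_graph_def)
  then have "\<exists>k. ?P k" by (intro exI[of _ "size (edges G)"] exI[of _ "edges G"]) simp
  from LeastI_ex[OF this] have "?P 0" unfolding L .
  then have "\<not> connected_graph (Mgraph (verts G) (edges G))" by simp
  then show False using G by (cases G) simp
qed

text \<open>Only the boundary edges inside the copies \<open>{u} \<times> H\<close> are counted;
  there \<open>A\<close> cuts \<open>H\<close> along its slice over \<open>u\<close>.\<close>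

lemma boundary_size_cart_prod_ge:
  assumes "finite (verts G)"
  shows "(\<Sum>u\<in>verts G. boundary_size H {v \<in> verts H. (u, v) \<in> A}) \<le> boundary_size (G \<box> H) A"
proof -
  let ?P = "\<lambda>e. e \<inter> A \<noteq> {} \<and> e \<inter> (verts G \<times> verts H - A) \<noteq> {}"
  have fsum: "size (filter_mset ?P (\<Sum>u\<in>W. M u)) = (\<Sum>u\<in>W. size (filter_mset ?P (M u)))"
    if "finite W" for W :: "'a set" and M :: "'a \<Rightarrow> ('a \<times> 'b) set multiset"
    using that by (induction W) auto
  have "boundary_size H {v \<in> verts H. (u, v) \<in> A} \<le> size (filter_mset ?P {#{u} \<times> e. e \<in># edges H#})"
    if u: "u \<in> verts G" for u
  proof -
    have "{#e \<in># edges H. e \<inter> {v \<in> verts H. (u, v) \<in> A} \<noteq> {}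
              \<and> e \<inter> (verts H - {v \<in> verts H. (u, v) \<in> A}) \<noteq> {}#}
        \<subseteq># {#e \<in># edges H. ?P ({u} \<times> e)#}"
      using u by (intro filter_mset_mono_strong) auto
    then show ?thesis unfolding boundary_size_def
      by (simp add: filter_mset_image_mset size_mset_mono)
  qed
  then have "(\<Sum>u\<in>verts G. boundary_size H {v \<in> verts H. (u, v) \<in> A})
      \<le> (\<Sum>u\<in>verts G. size (filter_mset ?P {#{u} \<times> e. e \<in># edges H#}))"
    by (rule sum_mono)
  also have "\<dots> \<le> boundary_size (G \<box> H) A"
    unfolding boundary_size_def cart_prod_def using assms by (simp add: fsum)
  finally show ?thesis .
qed

lemma verts_cart_prod [simp]: "verts (G \<box> H) = verts G \<times> verts H"
  by (simp add: cart_prod_def)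

lemma connected_fibre:
  assumes G: "mgraph G" "connected_graph G" and H: "mgraph H" and v: "v \<in> verts H"
  shows "connected_graph (induced (G \<box> H) (verts G \<times> {v}))"
proof -
  let ?I = "induced (G \<box> H) (verts G \<times> {v})"
  have step: "adjacent ?I (a, v) (b, v)" if "adjacent G a b" for a b
  proof -
    have ab: "a \<in> verts G" "b \<in> verts G" "a \<noteq> b"
      using that G(1) by (auto simp: adjacent_def mgraph_def)
    have "0 < mult G a b" using that by (simp add: adjacent_def mult_def)
    then have "0 < mult (G \<box> H) (a, v) (b, v)"
      using ab v mult_cart_prod[OF G(1) H, of a b v v] by simp
    then show ?thesis using ab by (simp add: adjacent_def mult_def induced_def)
  qed
  have "(adjacent ?I)\<^sup>*\<^sup>* (a, v) (b, v)" if "(adjacent G)\<^sup>*\<^sup>* a b" for a b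
    using that by (induction rule: rtranclp_induct) (auto intro: rtranclp.rtrancl_into_rtrancl step)
  then show ?thesis using G by (auto simp: connected_graph_def induced_def)
qed

text \<open>The guard in \<open>le\<close> reflects that a one-vertex \<open>H\<close> yields a
  single egg, so no egg cut exists, while \<open>edge_connectivity H\<close> is 0 by
  convention.\<close>

lemma scramble_number_cart_prod_ge:
  assumes G: "mgraph G" "connected_graph G" and H: "mgraph H"
    and le: "2 \<le> card (verts H) \<Longrightarrow> n \<le> card (verts G) * edge_connectivity H"
    and n: "n \<le> card (verts H)"
  shows "enat n \<le> scramble_number (G \<box> H)"
proof -
  let ?S = "(\<lambda>v. verts G \<times> {v}) ` verts H"
  have fin: "finite (verts G)" "finite (verts H)" using G H by (auto simp: mgraph_def)
  have ne: "verts G \<noteq> {}" using G by (simp add: connected_graph_def)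
  have "scramble (G \<box> H) ?S"
    using fin ne connected_fibre[OF G H] by (auto simp: scramble_def)
  moreover have "enat n \<le> hitting_number (G \<box> H) ?S"
    unfolding hitting_number_def
  proof (rule INF_greatest)
    fix C assume "C \<in> {C. C \<subseteq> verts (G \<box> H) \<and> (\<forall>A\<in>?S. C \<inter> A \<noteq> {})}"
    then have C: "finite C" "verts H \<subseteq> snd ` C" using fin by (force dest: finite_subset)+
    then have "card (verts H) \<le> card C" by (meson card_image_le card_mono finite_imageI order_trans)
    then show "enat n \<le> enat (card C)" using n by simp
  qed
  moreover have "enat n \<le> egg_cut_number (G \<box> H) ?S"
    unfolding egg_cut_number_def
  proof (rule INF_greatest)
    fix A assume "A \<in> {A. A \<subseteq> verts (G \<box> H) \<and> (\<exists>X\<in>?S. X \<subseteq> A) \<and> (\<exists>Y\<in>?S. Y \<subseteq> verts (G \<box> H) - A)}"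
    then obtain v w where vw: "v \<in> verts H" "w \<in> verts H"
      and v: "verts G \<times> {v} \<subseteq> A" and w: "verts G \<times> {w} \<subseteq> verts G \<times> verts H - A" by auto
    \<comment> \<open>Two separated eggs lie over distinct vertices. Every slice of \<open>A\<close>
      contains \<open>v\<close> and omits \<open>w\<close>, so it is a proper cut of
      \<open>H\<close>.\<close>
    have "v \<noteq> w" using v w ne by auto
    then have "2 \<le> card (verts H)" using vw fin card_mono[of "verts H" "{v, w}"] by simp
    then have "n \<le> (\<Sum>u\<in>verts G. edge_connectivity H)" using le by simp
    also have "\<dots> \<le> (\<Sum>u\<in>verts G. boundary_size H {v \<in> verts H. (u, v) \<in> A})"
      using vw v w by (intro sum_mono edge_connectivity_le_boundary_size[OF H]) auto
    also have "\<dots> \<le> boundary_size (G \<box> H) A" by (rule boundary_size_cart_prod_ge[OF fin(1)])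
    finally show "enat n \<le> enat (boundary_size (G \<box> H) A)" by simp
  qed
  ultimately show ?thesis
    unfolding scramble_number_def scramble_order_def by (intro SUP_upper2[of ?S]) auto
qed


section \<open>Upper bounds for the gonality of a product\<close>

text \<open>Edges coming from \<open>G\<close> join vertices with equal script values and contribute
  nothing; only the copy of \<open>H\<close> through \<open>(a, b)\<close> remains.\<close>

lemma laplacian_cart_prod_snd:
  assumes "mgraph G" "mgraph H" "a \<in> verts G" "b \<in> verts H"
  shows "laplacian (G \<box> H) (\<lambda>p. f (snd p)) (a, b) = laplacian H f b"
proof -
  have "laplacian (G \<box> H) (\<lambda>p. f (snd p)) (a, b)
      = (\<Sum>c\<in>verts G. \<Sum>d\<in>verts H. int (mult (G \<box> H) (a, b) (c, d)) * (f b - f d))"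
    by (simp add: laplacian_def sum.cartesian_product split_def)
  also have "\<dots> = (\<Sum>c\<in>verts G. if c = a then laplacian H f b else 0)"
    unfolding laplacian_def using assms by (intro sum.cong refl) (auto simp: mult_cart_prod intro!: sum.neutral)
  also have "\<dots> = laplacian H f b" using assms by (simp add: mgraph_def)
  finally show ?thesis .
qed

lemma laplacian_cart_prod_fst:
  assumes "mgraph G" "mgraph H" "a \<in> verts G" "b \<in> verts H"
  shows "laplacian (G \<box> H) (\<lambda>p. f (fst p)) (a, b) = laplacian G f a"
proof -
  have "laplacian (G \<box> H) (\<lambda>p. f (fst p)) (a, b)
      = (\<Sum>c\<in>verts G. \<Sum>d\<in>verts H. int (mult (G \<box> H) (a, b) (c, d)) * (f a - f c))"
    by (simp add: laplacian_def sum.cartesian_product split_def)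
  also have "\<dots> = (\<Sum>c\<in>verts G. \<Sum>d\<in>verts H. if d = b then int (mult G a c) * (f a - f c) else 0)"
    using assms by (intro sum.cong refl) (auto simp: mult_cart_prod)
  also have "\<dots> = laplacian G f a" using assms by (simp add: mgraph_def laplacian_def)
  finally show ?thesis .
qed

lemma gonality_cart_prod_le:
  assumes G: "mgraph G" and H: "mgraph H"
  shows "gonality (G \<box> H) \<le> card (verts G) * gonality H"
proof -
  obtain D where D: "positive_rank H D" "deg H D = int (gonality H)"
    using gonality_attained[OF H] by blast
  let ?D = "\<lambda>p. if p \<in> verts G \<times> verts H then D (snd p) else 0"
  have "deg (G \<box> H) ?D = (\<Sum>p\<in>verts G \<times> verts H. D (snd p))"
    by (auto simp: deg_def intro: sum.cong)
  also have "\<dots> = (\<Sum>a\<in>verts G. deg H D)"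
    unfolding deg_def sum.cartesian_product by (simp add: split_def)
  finally have "deg (G \<box> H) ?D = int (card (verts G) * gonality H)" using D by simp
  moreover have "positive_rank (G \<box> H) ?D"
    unfolding positive_rank_iff[OF mgraph_cart_prod[OF G H]]
  proof
    fix p assume "p \<in> verts (G \<box> H)"
    then have "snd p \<in> verts H" by auto
    then obtain f where f: "\<And>w. w \<in> verts H \<Longrightarrow> of_bool (w = snd p) \<le> D w - laplacian H f w"
      using D(1) unfolding positive_rank_iff[OF H] by blast
    show "\<exists>f. \<forall>w\<in>verts (G \<box> H). of_bool (w = p) \<le> ?D w - laplacian (G \<box> H) f w"
    \<comment> \<open>The lifted script acts alike in every copy of \<open>H\<close>, so it puts a
      chip on the whole fibre over \<open>snd p\<close>, hence on \<open>p\<close>.\<close>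
    proof (intro exI[of _ "\<lambda>p. f (snd p)"] ballI)
      fix w assume "w \<in> verts (G \<box> H)"
      then obtain a b where w: "w = (a, b)" "a \<in> verts G" "b \<in> verts H" by auto
      have "of_bool (w = p) \<le> (of_bool (b = snd p) :: int)" using w by auto
      also have "\<dots> \<le> D b - laplacian H f b" using f w by simp
      finally show "of_bool (w = p) \<le> ?D w - laplacian (G \<box> H) (\<lambda>p. f (snd p)) w"
        using w by (simp add: laplacian_cart_prod_snd[OF G H])
    qed
  qed
  ultimately show ?thesis by (intro gonality_le) (auto simp: divisor_def)
qed

section \<open>Bridges in acyclic graphs and moving chips on trees\<close>

lemma rtranclp_simple_path:
  assumes "R\<^sup>*\<^sup>* x y"
  shows "\<exists>vs. vs \<noteq> [] \<and> distinct vs \<and> hd vs = x \<and> last vs = y \<and>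
    (\<forall>i. Suc i < length vs \<longrightarrow> R (vs ! i) (vs ! Suc i))"
  using assms
proof (induction rule: rtranclp_induct)
  case base
  show ?case by (intro exI[of _ "[x]"]) simp
next
  case (step y z)
  then obtain vs where vs: "vs \<noteq> []" "distinct vs" "hd vs = x" "last vs = y"
    and R: "\<And>i. Suc i < length vs \<Longrightarrow> R (vs ! i) (vs ! Suc i)" by blast
  show ?case
  proof (cases "z \<in> set vs")
    \<comment> \<open>The walk returns to \<open>z\<close>, so the path is cut at its earlier
      visit.\<close>
    case True
    then obtain as bs where s: "vs = as @ z # bs" by (meson split_list)
    have "R ((as @ [z]) ! i) ((as @ [z]) ! Suc i)" if "Suc i < length (as @ [z])" for i
      using R[of i] that unfolding s by (auto simp: nth_append split: if_splits)
    then show ?thesis using vs unfolding s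
      by (intro exI[of _ "as @ [z]"]) (auto simp: hd_append)
  next
    case False
    have "R ((vs @ [z]) ! i) ((vs @ [z]) ! Suc i)" if "Suc i < length (vs @ [z])" for i
    proof (cases "Suc i < length vs")
      case True
      then show ?thesis using R[of i] by (simp add: nth_append)
    next
      case False
      then have "i = length vs - 1" "Suc i = length vs" using that by auto
      then show ?thesis using vs step(2) by (simp add: nth_append last_conv_nth)
    qed
    then show ?thesis using vs False by (intro exI[of _ "vs @ [z]"]) auto
  qed
qed

text \<open>A simple path from \<open>x\<close> to \<open>y\<close> in the remaining edges would
  close up with the deleted edge to a cycle. Only one copy of \<open>{x, y}\<close> is deleted, so a
  parallel edge counts as such a path.\<close>

lemma edge_of_acyclic_is_bridge:
  assumes acyc: "\<nexists>vs. is_cycle G vs" and e: "{x, y} \<in># edges G" "x \<noteq> y"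
  shows "\<not> (adjacent (Mgraph (verts G) (edges G - {#{x, y}#})))\<^sup>*\<^sup>* x y"
proof
  let ?E = "edges G - {#{x, y}#}"
  assume path: "(adjacent (Mgraph (verts G) ?E))\<^sup>*\<^sup>* x y"
  then obtain vs where vs: "vs \<noteq> []" "distinct vs" "hd vs = x" "last vs = y"
    and R: "\<And>i. Suc i < length vs \<Longrightarrow> {vs ! i, vs ! Suc i} \<in># ?E"
    using rtranclp_simple_path[OF path] unfolding adjacent_def mgraph.sel by blast
  obtain m where m: "length vs = Suc m" using vs(1) by (cases vs) auto
  have m0: "vs ! 0 = x" "vs ! m = y" using vs m by (auto simp: hd_conv_nth last_conv_nth)
  have mpos: "0 < m" using m0 e(2) by (cases m) auto
  \<comment> \<open>Distinct vertices give distinct path edges, so multiset inclusion in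
    \<open>?E\<close> reduces to membership.\<close>
  have inj: "inj_on (\<lambda>i. {vs ! i, vs ! Suc i}) {..<m}"
  proof (rule inj_onI)
    fix i j assume ij: "i \<in> {..<m}" "j \<in> {..<m}" "{vs ! i, vs ! Suc i} = {vs ! j, vs ! Suc j}"
    then show "i = j" using m vs(2) by (auto simp: doubleton_eq_iff nth_eq_iff_index_eq)
  qed
  have "{#{vs ! i, vs ! Suc i}. i \<in># mset_set {..<m}#} = mset_set ((\<lambda>i. {vs ! i, vs ! Suc i}) ` {..<m})"
    using inj by (rule image_mset_mset_set)
  also have "\<dots> \<subseteq># mset_set (set_mset ?E)"
    using R m by (intro subset_imp_msubset_mset_set) auto
  also have "\<dots> \<subseteq># ?E"
    by (rule mset_set_set_mset_msubset)
  finally have "{#{vs ! i, vs ! Suc i}. i \<in># mset_set {..<m}#} + {#{x, y}#} \<subseteq># ?E + {#{x, y}#}"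
    by (rule subset_mset.add_right_mono)
  then have *: "{#{vs ! i, vs ! Suc i}. i \<in># mset_set {..<m}#} + {#{x, y}#} \<subseteq># edges G"
    using e(1) by simp
  \<comment> \<open>The last index \<open>m\<close> wraps around to 0 and contributes the closing
    edge \<open>{x, y}\<close>.\<close>
  have "{#{vs ! i, vs ! (Suc i mod length vs)}. i \<in># mset_set {..<length vs}#}
      = {#{vs ! i, vs ! (Suc i mod Suc m)}. i \<in># mset_set {..<m}#} + {#{x, y}#}"
    unfolding m lessThan_Suc using m0 by (simp add: insert_commute)
  also have "{#{vs ! i, vs ! (Suc i mod Suc m)}. i \<in># mset_set {..<m}#}
      = {#{vs ! i, vs ! Suc i}. i \<in># mset_set {..<m}#}"
    by (intro image_mset_cong) auto
  finally have "is_cycle G vs" using * m mpos vs(2) by (simp add: is_cycle_def)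
  then show False using acyc by blast
qed

text \<open>Firing the side of a tree edge that contains one endpoint moves a single chip across the edge.\<close>

lemma tree_adjacent_script:
  assumes G: "mgraph G" "tree G" and adj: "adjacent G x y"
  shows "\<exists>f. \<forall>v. laplacian G f v = of_bool (v = x) - of_bool (v = y)"
proof -
  have fin: "finite (verts G)" using G by (simp add: mgraph_def)
  have e: "{x, y} \<in># edges G" using adj by (simp add: adjacent_def)
  have xy: "x \<in> verts G" "y \<in> verts G" "x \<noteq> y" using e G(1) by (auto simp: mgraph_def)
  let ?H = "Mgraph (verts G) (edges G - {#{x, y}#})"
  define U where "U = {v \<in> verts G. (adjacent ?H)\<^sup>*\<^sup>* x v}"
  have U: "U \<subseteq> verts G" "x \<in> U" using xy by (auto simp: U_def)
  have "y \<notin> U" using edge_of_acyclic_is_bridge[OF _ e xy(3)] G(2) by (simp add: U_def tree_def)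
  have closed: "\<not> {a, b} \<in># edges G - {#{x, y}#}" if "a \<in> U" "b \<in> verts G - U" for a b
    using that rtranclp.rtrancl_into_rtrancl[of "adjacent ?H" x a b]
    by (auto simp: U_def adjacent_def)
  \<comment> \<open>The deleted edge is the only edge leaving \<open>U\<close>, and its multiplicity
    is one.\<close>
  have cross: "int (mult G a b) = (if a = x \<and> b = y then 1 else 0)" if "a \<in> U" "b \<in> verts G - U" for a b
  proof -
    have c: "count (edges G - {#{x, y}#}) {a, b} = 0"
      using closed[OF that] unfolding count_eq_zero_iff .
    show ?thesis
    proof (cases "a = x \<and> b = y")
      case True
      then have "count (edges G) {x, y} \<le> 1" using c by simp
      moreover have "1 \<le> count (edges G) {x, y}" using e by (simp add: Suc_le_eq)
      ultimately have "count (edges G) {x, y} = 1" by (rule order_antisym)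
      then show ?thesis using True by (simp add: mult_def)
    next
      case False
      then have "{a, b} \<noteq> {x, y}" using that U \<open>y \<notin> U\<close> by (auto simp: doubleton_eq_iff)
      then show ?thesis using c False by (simp add: mult_def)
    qed
  qed
  have "laplacian G (\<lambda>v. of_bool (v \<in> U)) v = of_bool (v = x) - of_bool (v = y)" for v
  proof -
    consider "v \<in> U" | "v \<in> verts G - U" | "v \<notin> verts G" by blast
    then show ?thesis
    proof cases
      case 1
      have "laplacian G (\<lambda>v. of_bool (v \<in> U)) v = (\<Sum>w\<in>verts G - U. if w = y then of_bool (v = x) else 0)"
        unfolding laplacian_indicator_inside[OF fin 1] using cross[OF 1] by (intro sum.cong refl) auto
      also have "\<dots> = of_bool (v = x)" using fin xy \<open>y \<notin> U\<close> by simp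
      finally show ?thesis using 1 \<open>y \<notin> U\<close> by auto
    next
      case 2
      have "(\<Sum>u\<in>U. int (mult G v u)) = (\<Sum>u\<in>U. if u = x then of_bool (v = y) else 0)"
        using cross[OF _ 2] by (intro sum.cong refl) (auto simp: mult_commute[of G v])
      also have "\<dots> = of_bool (v = y)" using U fin finite_subset[of U] by auto
      finally show ?thesis using 2 U laplacian_indicator_outside[OF fin U(1), of v] by auto
    next
      case 3
      then show ?thesis using xy by (auto simp: laplacian_outside[OF G(1)])
    qed
  qed
  then show ?thesis by blast
qed

text \<open>Scripts for the single edges of a walk from \<open>x\<close> to \<open>y\<close> add up,
  and the intermediate terms cancel.\<close>

lemma tree_script:
  assumes G: "mgraph G" "tree G" and xy: "x \<in> verts G" "y \<in> verts G"
  shows "\<exists>f. \<forall>v. laplacian G f v = of_bool (v = x) - of_bool (v = y)"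
proof -
  have "(adjacent G)\<^sup>*\<^sup>* x y" using G xy by (simp add: tree_def connected_graph_def)
  then show ?thesis
  proof (induction rule: rtranclp_induct)
    case base
    show ?case by (intro exI[of _ "\<lambda>_. 0"]) (simp add: laplacian_const)
  next
    case (step y z)
    then obtain f g where "\<forall>v. laplacian G f v = of_bool (v = x) - of_bool (v = y)"
      "\<forall>v. laplacian G g v = of_bool (v = y) - of_bool (v = z)"
      using tree_adjacent_script[OF G] by metis
    then show ?case by (intro exI[of _ "\<lambda>v. f v + g v"]) (simp add: laplacian_add)
  qed
qed

lemma gonality_tree_cart_prod_le:
  assumes G: "mgraph G" "tree G" and H: "mgraph H"
  shows "gonality (G \<box> H) \<le> card (verts H)"
proof -
  have fin: "finite (verts G)" "finite (verts H)" using G H by (auto simp: mgraph_def)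
  obtain x where x: "x \<in> verts G" using G by (auto simp: tree_def connected_graph_def)
  let ?D = "\<lambda>p. of_bool (p \<in> {x} \<times> verts H) :: int"
  have "deg (G \<box> H) ?D = (\<Sum>p\<in>verts G \<times> verts H. if p \<in> {x} \<times> verts H then 1 else 0)"
    by (auto simp: deg_def intro: sum.cong)
  also have "\<dots> = (\<Sum>p\<in>(verts G \<times> verts H) \<inter> ({x} \<times> verts H). 1)"
    using fin by (subst sum.inter_restrict) auto
  also have "(verts G \<times> verts H) \<inter> ({x} \<times> verts H) = {x} \<times> verts H" using x by auto
  finally have "deg (G \<box> H) ?D = int (card (verts H))" by (simp add: card_cartesian_product)
  moreover have "positive_rank (G \<box> H) ?D"
    unfolding positive_rank_iff[OF mgraph_cart_prod[OF G(1) H]]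
  proof
    fix p assume "p \<in> verts (G \<box> H)"
    then have "fst p \<in> verts G" by auto
    then obtain f where f: "\<forall>v. laplacian G f v = of_bool (v = x) - of_bool (v = fst p)"
      using tree_script[OF G x] by blast
    show "\<exists>f. \<forall>w\<in>verts (G \<box> H). of_bool (w = p) \<le> ?D w - laplacian (G \<box> H) f w"
    \<comment> \<open>The lifted script moves all chips from the copy of \<open>H\<close> at
      \<open>x\<close> to the copy at \<open>fst p\<close>.\<close>
    proof (intro exI[of _ "\<lambda>p. f (fst p)"] ballI)
      fix w assume "w \<in> verts (G \<box> H)"
      then obtain a b where w: "w = (a, b)" "a \<in> verts G" "b \<in> verts H" by auto
      then show "of_bool (w = p) \<le> ?D w - laplacian (G \<box> H) (\<lambda>p. f (fst p)) w"
        using f by (auto simp: laplacian_cart_prod_fst[OF G(1) H])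
    qed
  qed
  ultimately show ?thesis using x by (intro gonality_le) (auto simp: divisor_def)
qed

theorem theorem5p1:
  fixes G :: "'a mgraph" and H :: "'b mgraph"
  assumes "mgraph G" and "connected_graph G"
    and "mgraph H" and "connected_graph H"
  shows "(tree G \<and>
            real (card (verts H)) / real (edge_connectivity H) \<le> real (card (verts G)) \<longrightarrow>
            scramble_number (G \<box> H) = enat (card (verts H)) \<and>
            gonality (G \<box> H) = card (verts H)) \<and>
         (gonality H = edge_connectivity H \<and>
            real (card (verts G)) \<le> real (card (verts H)) / real (edge_connectivity H) \<longrightarrow>
            scramble_number (G \<box> H) = enat (card (verts G) * edge_connectivity H) \<and>
            gonality (G \<box> H) = card (verts G) * edge_connectivity H)"
proof -
  have "verts (G \<box> H) \<noteq> {}" using assms by (auto simp: connected_graph_def)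
  then have sn_le: "scramble_number (G \<box> H) \<le> enat (gonality (G \<box> H))"
    using scramble_number_le_gonality mgraph_cart_prod assms by blast
  have sandwich: "scramble_number (G \<box> H) = enat n \<and> gonality (G \<box> H) = n"
    if "enat n \<le> scramble_number (G \<box> H)" "gonality (G \<box> H) \<le> n" for n
  proof -
    have "enat n \<le> enat (gonality (G \<box> H))" using that sn_le order_trans by blast
    then have "gonality (G \<box> H) = n" using that by simp
    then show ?thesis using that sn_le by simp
  qed
  have pos: "0 < edge_connectivity H" if "2 \<le> card (verts H)"
    using edge_connectivity_pos assms that by blast
  show ?thesis
  proof (intro conjI[of "_ \<longrightarrow> _"] impI; elim conjE)
    assume "tree G" and ratio: "real (card (verts H)) / real (edge_connectivity H) \<le> real (card (verts G))"
    \<comment> \<open>With two vertices \<open>edge_connectivity H\<close> is positive, so the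
      quotient is a genuine one and can be cleared.\<close>
    have "card (verts H) \<le> card (verts G) * edge_connectivity H" if "2 \<le> card (verts H)"
    proof -
      have "real (card (verts H)) \<le> real (card (verts G) * edge_connectivity H)"
        using ratio pos[OF that] by (simp add: pos_divide_le_eq)
      then show ?thesis by (simp only: of_nat_le_iff)
    qed
    then show "scramble_number (G \<box> H) = enat (card (verts H)) \<and> gonality (G \<box> H) = card (verts H)"
      using assms \<open>tree G\<close>
      by (intro sandwich scramble_number_cart_prod_ge gonality_tree_cart_prod_le) auto
  next
    assume gon: "gonality H = edge_connectivity H"
      and ratio: "real (card (verts G)) \<le> real (card (verts H)) / real (edge_connectivity H)"
    have "card (verts G) * edge_connectivity H \<le> card (verts H)"
    proof (cases "edge_connectivity H = 0")
      case False
      then have "real (card (verts G) * edge_connectivity H) \<le> real (card (verts H))"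
        using ratio by (simp add: pos_le_divide_eq)
      then show ?thesis by (simp only: of_nat_le_iff)
    qed simp
    then show "scramble_number (G \<box> H) = enat (card (verts G) * edge_connectivity H) \<and>
        gonality (G \<box> H) = card (verts G) * edge_connectivity H"
      using assms gonality_cart_prod_le[of G H] gon
      by (intro sandwich scramble_number_cart_prod_ge) auto
  qed
qed

end
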